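(* Let $R$ be a finite non-commutative ring. Then $$\Pr(R) \geq \frac{2|Z(R)|}{|R|} + \frac{1}{|R|} - \frac{|Z(R)|^2}{|R|^2} - \frac{|Z(R)|}{|R|^2}.$$
   Context: Rings are associative and not assumed to have a unity. $Z(R)$ is the center of $R$, and $\Pr(R) = \frac{|\{(r,t) \in R \times R : rt = tr\}|}{|R|^2}$ is the commuting probability of $R$. *)

theory Defs
  imports Complex_Main "HOL-Library.Cardinality"
begin

text \<open>
  The type class \<^class>\<open>ring\<close> is an associative ring in which multiplication need neither be
  commutative nor have a unit.
\<close>

definition ring_center :: "'a::ring set" where
  "ring_center = {z. \<forall>r. z * r = r * z}"

definition commuting_probability :: "'a::{ring,finite} itself \<Rightarrow> real" where
  "commuting_probability _ =
     real (card {(r, t). r * t = t * (r :: 'a)}) / (real CARD('a))\<^sup>2"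

end

theory Submission
  imports Defs
begin

text \<open>
  Summing centralizer sizes over all elements counts the commuting pairs. The centralizer of a
  central element is the whole ring, and the centralizer of a non-central element \<open>r\<close> contains
  the center together with \<open>r\<close>.
\<close>

lemma card_commuting_pairs:
  "card {(r, t). r * t = t * (r :: 'a::{ring,finite})} = (\<Sum>r::'a\<in>UNIV. card {t. r * t = t * r})"
proof -
  \<comment> \<open>Fibring the pairs over their first entry turns the cardinality into a sum over
    the fibres.\<close>
  have "{(r, t). r * t = t * (r :: 'a)} = (SIGMA r:UNIV. {t. r * t = t * r})"
    by auto
  then show ?thesis
    by simp
qed

lemma card_centralizer_central:
  fixes r :: "'a::{ring,finite}"
  assumes "r \<in> ring_center"
  shows "card {t. r * t = t * r} = CARD('a)"
proof -
  have "{t. r * t = t * r} = UNIV"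
    using assms by (auto simp: ring_center_def)
  then show ?thesis
    by simp
qed

lemma card_centralizer_noncentral:
  fixes r :: "'a::{ring,finite}"
  assumes "r \<notin> ring_center"
  shows "card (ring_center :: 'a set) + 1 \<le> card {t. r * t = t * r}"
proof -
  have "insert r ring_center \<subseteq> {t. r * t = t * r}"
    by (auto simp: ring_center_def)
  then have "card (insert r ring_center) \<le> card {t. r * t = t * r}"
    by (intro card_mono) auto
  \<comment> \<open>As \<open>r\<close> is not central, inserting it enlarges the center by exactly
    one element.\<close>
  then show ?thesis
    using assms by simp
qed

theorem proposition4p5:
  assumes noncommutative: "\<exists>r t :: 'a::{ring,finite}. r * t \<noteq> t * r"
  shows "commuting_probability TYPE('a) \<ge>
           2 * real (card (ring_center :: 'a set)) / real CARD('a)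
           + 1 / real CARD('a)
           - (real (card (ring_center :: 'a set)))\<^sup>2 / (real CARD('a))\<^sup>2
           - real (card (ring_center :: 'a set)) / (real CARD('a))\<^sup>2"
proof -
  define Z where "Z = (ring_center :: 'a set)"
  define z n where "z = real (card Z)" and "n = real CARD('a)"
  let ?C = "\<lambda>r::'a. card {t. r * t = t * r}"
  have n: "n > 0"
    by (simp add: n_def)
  \<comment> \<open>\<open>card_mono\<close> gives \<open>card Z \<le> CARD('a)\<close>, so the
    natural-number subtraction is not truncated.\<close>
  have card_compl: "real (card (- Z)) = n - z"
    by (simp add: Compl_eq_Diff_UNIV card_Diff_subset z_def n_def of_nat_diff card_mono)
  \<comment> \<open>The left side is the claimed bound times \<open>n\<^sup>2\<close>. The right
    side counts \<open>n\<close> for each of the \<open>z\<close> central elements and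
    \<open>z + 1\<close> for each of the \<open>n - z\<close> others.\<close>
  have "2 * z * n + n - z\<^sup>2 - z = z * n + (n - z) * (z + 1)"
    by (simp add: algebra_simps power2_eq_square)
  also have "\<dots> = (\<Sum>r\<in>Z. n) + (\<Sum>r\<in>-Z. z + 1)"
    by (simp add: card_compl z_def)
  also have "\<dots> \<le> (\<Sum>r\<in>Z. real (?C r)) + (\<Sum>r\<in>-Z. real (?C r))"
  proof (intro add_mono sum_mono)
    show "n \<le> real (?C r)" if "r \<in> Z" for r
      using card_centralizer_central[of r] that by (simp add: Z_def n_def)
    show "z + 1 \<le> real (?C r)" if "r \<in> - Z" for r
      using card_centralizer_noncentral[of r] that by (simp add: Z_def z_def)
  qed
  also have "\<dots> = (\<Sum>r\<in>UNIV. real (?C r))"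
    by (subst sum.union_disjoint[symmetric]) auto
  also have "\<dots> = real (card {(r, t). r * t = t * (r :: 'a)})"
    by (simp add: card_commuting_pairs)
  finally have "(2 * z * n + n - z\<^sup>2 - z) / n\<^sup>2 \<le> commuting_probability TYPE('a)"
    by (simp add: commuting_probability_def n_def divide_right_mono)
  \<comment> \<open>Since \<open>n\<close> is nonzero, one factor \<open>n\<close> cancels in the
    first two terms.\<close>
  moreover have "(2 * z * n + n - z\<^sup>2 - z) / n\<^sup>2 = 2 * z / n + 1 / n - z\<^sup>2 / n\<^sup>2 - z / n\<^sup>2"
    using n by (simp add: field_simps power2_eq_square)
  ultimately show ?thesis
    by (simp add: z_def n_def Z_def)
qed

end
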